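(* For any graph $G$ and any graph $H$ with root $v\in V(H)$, $$\chi_i(G\circ_v H)\in\{\chi_i(G),\ \chi_i(H),\ \chi_i(G)+1,\ \chi_i(H)+1,\ \Delta(G)+d_H(v),\ \Delta(G)+d_H(v)+1\}.$$
   Context: An injective $k$-coloring of a graph is a map $f:V\to\{1,\dots,k\}$ such that no vertex has two neighbors $u\neq w$ with $f(u)=f(w)$; $\chi_i$ denotes the least such $k$. For a graph $G$ with $V(G)=\{v_1,\ldots,v_n\}$ and a graph $H$ with root $v$, the rooted product $G\circ_v H$ has vertex set $V(G)\times V(H)$ and edge set $\bigcup_{i=1}^n\{(v_i,h)(v_i,h') : hh'\in E(H)\}\cup\{(v_i,v)(v_j,v): v_iv_j\in E(G)\}$ (i.e., a copy of $H$ is attached to each vertex $v_i$ of $G$ by identifying its root with $v_i$). $\Delta(G)$ is the maximum degree of $G$ and $d_H(v)$ the degree of $v$ in $H$. *)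

theory Defs
  imports "Graph_Theory.Pair_Digraph"
begin

(* A finite simple undirected graph is a pair_graph: a finite loop-free symmetric pair digraph,
   each edge uw being represented by the two arcs (u,w) and (w,u). Hence the out-degree of a
   vertex is its degree. The null graph is a pair_graph. *)

abbreviation degree :: "'a pair_pre_digraph \<Rightarrow> 'a \<Rightarrow> nat" where
  "degree G u \<equiv> out_degree (with_proj G) u"

(* On nat, the supremum of a finite nonempty set is its maximum, and Sup {} = 0. *)
definition max_degree :: "'a pair_pre_digraph \<Rightarrow> nat" where
  "max_degree G = (SUP u\<in>pverts G. degree G u)"

definition injective_coloring :: "'a pair_pre_digraph \<Rightarrow> nat \<Rightarrow> ('a \<Rightarrow> nat) \<Rightarrow> bool" where
  "injective_coloring G k f \<longleftrightarrow>
     f ` pverts G \<subseteq> {1..k} \<and>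
     (\<forall>x\<in>pverts G. \<forall>u w. (x, u) \<in> parcs G \<and> (x, w) \<in> parcs G \<and> u \<noteq> w \<longrightarrow> f u \<noteq> f w)"

definition injective_chromatic_number :: "'a pair_pre_digraph \<Rightarrow> nat" where
  "injective_chromatic_number G = (LEAST k. \<exists>f. injective_coloring G k f)"

definition rooted_product ::
  "'a pair_pre_digraph \<Rightarrow> 'b pair_pre_digraph \<Rightarrow> 'b \<Rightarrow> ('a \<times> 'b) pair_pre_digraph" where
  "rooted_product G H v =
     \<lparr> pverts = pverts G \<times> pverts H,
       parcs = {((g, h), (g, h')) | g h h'. g \<in> pverts G \<and> (h, h') \<in> parcs H} \<union>
               {((g, v), (g', v)) | g g'. (g, g') \<in> parcs G} \<rparr>"

lemma injective_coloring_exists: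
  assumes "pair_graph G"
  shows "\<exists>k f. injective_coloring G k f"
proof -
  interpret pair_graph G by fact
  obtain f :: "'a \<Rightarrow> nat" where f: "bij_betw f (pverts G) {1..card (pverts G)}"
    using ex_bij_betw_finite_nat[OF pair_finite_verts]
      finite_same_card_bij[OF pair_finite_verts, of "{1..card (pverts G)}"] by auto
  have "injective_coloring G (card (pverts G)) f"
    using f unfolding injective_coloring_def bij_betw_def
    by (auto dest: in_arcsD2 inj_onD)
  then show ?thesis by blast
qed

lemma pair_graph_rooted_product:
  assumes "pair_graph G" and "pair_graph H" and "v \<in> pverts H"
  shows "pair_graph (rooted_product G H v)"
proof -
  interpret G: pair_graph G by fact
  interpret H: pair_graph H by fact
  let ?P = "rooted_product G H v"
  have fin: "finite (pverts ?P)"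
    by (simp add: rooted_product_def G.pair_finite_verts H.pair_finite_verts)
  have sub: "parcs ?P \<subseteq> pverts ?P \<times> pverts ?P"
    using assms(3) by (auto simp: rooted_product_def dest: G.in_arcsD1 G.in_arcsD2 H.in_arcsD1 H.in_arcsD2)
  have fina: "finite (parcs ?P)"
    by (rule finite_subset[OF sub]) (simp add: fin)
  have sym: "sym (parcs ?P)"
    by (rule symI) (auto simp: rooted_product_def dest: G.arcs_symmetric H.arcs_symmetric)
  have irrefl: "fst e \<noteq> snd e" if "e \<in> parcs ?P" for e
    using that by (auto simp: rooted_product_def dest: G.no_loops' H.no_loops')
  show ?thesis
    by unfold_locales (use fin fina sub sym irrefl in \<open>auto simp: symmetric_def\<close>)
qed

end

theory Submission
  imports Defs
begin

text \<open>
  Let \<open>M\<close> be the maximum of \<open>\<chi>\<^sub>i(G)\<close>, \<open>\<chi>\<^sub>i(H)\<close> and \<open>\<Delta>(G) + d\<^sub>H(v)\<close>; then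
  \<open>\<chi>\<^sub>i(G \<circ>\<^sub>v H)\<close> is \<open>M\<close> or \<open>M + 1\<close> unless \<open>G\<close> is null. A coloring of the product is injective iff
  it is so on \<open>G\<close> and on every copy of \<open>H\<close>, and at each root \<open>(g, v)\<close> the neighbours inside the
  copy and those inside \<open>G\<close> share no color. This gives the lower bound, as the neighbours of a
  single vertex need distinct colors. For the upper bound, color \<open>G\<close> by \<open>c\<close> and \<open>H\<close> by \<open>f\<close>, both
  with \<open>M\<close> colors. In the copy of \<open>H\<close> at \<open>g\<close>, rename the colors of \<open>f\<close> by an injection into the
  \<open>M\<close> elements of \<open>{1..M + 1} - {c(g)}\<close> that sends the at most \<open>d\<^sub>H(v)\<close> colors around \<open>v\<close> to colors
  not used by \<open>c\<close> around \<open>g\<close>, of which at least \<open>M - d\<^sub>G(g) \<ge> d\<^sub>H(v)\<close> are left; then \<open>c(g)\<close> is free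
  to be given to \<open>v\<close>.
\<close>

lemma ex_inj_on_image_subset:
  assumes "finite S" and "finite T" and "card S \<le> card T"
    and "A \<subseteq> S" and "B \<subseteq> T" and "card A \<le> card B"
  obtains p where "inj_on p S" and "p ` S \<subseteq> T" and "p ` A \<subseteq> B"
proof -
  have finite: "finite A" "finite B" using assms finite_subset by blast+
  obtain q where q: "q ` A \<subseteq> B" "inj_on q A"
    using card_le_inj[OF finite assms(6)] by blast
  have "card (S - A) = card S - card A"
    using finite(1) assms(4) by (rule card_Diff_subset)
  also have "\<dots> \<le> card T - card (q ` A)"
    using assms(3) q(2) by (simp add: card_image)
  also have "\<dots> = card (T - q ` A)"
    using finite(1) q(1) assms(5) by (intro card_Diff_subset[symmetric]) auto
  finally obtain r where r: "r ` (S - A) \<subseteq> T - q ` A" "inj_on r (S - A)"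
    using card_le_inj[of "S - A" "T - q ` A"] assms(1,2) by blast
  let ?p = "\<lambda>x. if x \<in> A then q x else r x"
  have "inj_on ?p (A \<union> (S - A))"
    using r(1) by (intro inj_on_disjoint_Un q(2) r(2)) auto
  then have "inj_on ?p S" using assms(4) by (simp add: Un_absorb1)
  moreover have "?p ` S \<subseteq> T" "?p ` A \<subseteq> B" using q(1) r(1) assms(5) by auto
  ultimately show thesis by (rule that)
qed

abbreviation neighbours :: "'a pair_pre_digraph \<Rightarrow> 'a \<Rightarrow> 'a set" where
  "neighbours G u \<equiv> parcs G `` {u}"

lemma degree_eq_card_neighbours: "degree G u = card (neighbours G u)"
proof -
  have "out_arcs (with_proj G) u = Pair u ` neighbours G u"
    by (auto simp: out_arcs_def)
  then show ?thesis
    by (simp add: out_degree_def card_image inj_on_def)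
qed

lemma (in pair_wf_digraph) neighbours_subset_pverts: "neighbours G u \<subseteq> pverts G"
  by (auto dest: in_arcsD2)

lemma (in pair_fin_digraph) finite_neighbours: "finite (neighbours G u)"
  using neighbours_subset_pverts pair_finite_verts by (rule finite_subset)

lemma (in pair_fin_digraph) degree_le_max_degree:
  assumes "u \<in> pverts G"
  shows "degree G u \<le> max_degree G"
  unfolding max_degree_def
  by (rule cSUP_upper[OF assms]) (simp add: pair_finite_verts)

lemma (in pair_fin_digraph) max_degree_attained:
  assumes "pverts G \<noteq> {}"
  obtains u where "u \<in> pverts G" and "degree G u = max_degree G"
proof -
  have "max_degree G = Max (degree G ` pverts G)"
    unfolding max_degree_def using assms pair_finite_verts by (simp add: cSup_eq_Max)
  also have "\<dots> \<in> degree G ` pverts G"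
    using assms pair_finite_verts by (intro Max_in) auto
  finally show thesis using that by auto
qed

lemma injective_coloring_iff_inj_on:
  "injective_coloring G k f \<longleftrightarrow>
     f ` pverts G \<subseteq> {1..k} \<and> (\<forall>x\<in>pverts G. inj_on f (neighbours G x))"
  unfolding injective_coloring_def inj_on_def by auto

lemma injective_coloring_image_subset:
  assumes "injective_coloring G k f"
  shows "f ` pverts G \<subseteq> {1..k}"
  using assms unfolding injective_coloring_def by blast

lemma injective_coloring_inj_on_neighbours:
  assumes "injective_coloring G k f" and "x \<in> pverts G"
  shows "inj_on f (neighbours G x)"
  using assms unfolding injective_coloring_iff_inj_on by blast

lemma injective_coloring_mono:
  assumes "injective_coloring G k f" and "k \<le> l"
  shows "injective_coloring G l f"
  using assms unfolding injective_coloring_def by force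

context pair_wf_digraph
begin

lemma injective_coloring_cong:
  assumes "\<And>x. x \<in> pverts G \<Longrightarrow> f x = g x"
  shows "injective_coloring G k f \<longleftrightarrow> injective_coloring G k g"
proof -
  have "f ` pverts G = g ` pverts G"
    using assms by (rule image_cong[OF refl])
  moreover have "inj_on f (neighbours G x) \<longleftrightarrow> inj_on g (neighbours G x)" for x
    using assms neighbours_subset_pverts by (intro inj_on_cong) blast
  ultimately show ?thesis by (simp add: injective_coloring_iff_inj_on)
qed

lemma injective_coloring_image_neighbours_subset:
  assumes "injective_coloring G k f"
  shows "f ` neighbours G x \<subseteq> {1..k}"
  using injective_coloring_image_subset[OF assms] neighbours_subset_pverts by blast

lemma injective_coloring_comp:
  assumes f: "injective_coloring G k f" and p: "inj_on p {1..k}" "p ` {1..k} \<subseteq> {1..l}"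
  shows "injective_coloring G l (p \<circ> f)"
  unfolding injective_coloring_iff_inj_on
proof (intro conjI ballI)
  show "(p \<circ> f) ` pverts G \<subseteq> {1..l}"
    using injective_coloring_image_subset[OF f] p(2) by (auto simp: image_subset_iff)
  fix x
  assume "x \<in> pverts G"
  with f have "inj_on f (neighbours G x)" by (rule injective_coloring_inj_on_neighbours)
  moreover have "f ` neighbours G x \<subseteq> {1..k}"
    using f by (rule injective_coloring_image_neighbours_subset)
  ultimately show "inj_on (p \<circ> f) (neighbours G x)"
    by (intro comp_inj_on inj_on_subset[OF p(1)])
qed

lemma injective_coloring_fun_upd_fresh:
  assumes f: "injective_coloring G k f" and a: "a \<in> {1..k}" "a \<notin> f ` pverts G"
  shows "injective_coloring G k (f(v := a))"
  unfolding injective_coloring_iff_inj_on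
proof (intro conjI ballI)
  show "(f(v := a)) ` pverts G \<subseteq> {1..k}"
    using injective_coloring_image_subset[OF f] a(1) by auto
  fix x
  assume "x \<in> pverts G"
  then show "inj_on (f(v := a)) (neighbours G x)"
    using injective_coloring_inj_on_neighbours[OF f] neighbours_subset_pverts a(2)
    by (intro inj_on_fun_updI) blast+
qed

lemma degree_le_injective_coloring:
  assumes f: "injective_coloring G k f" and u: "u \<in> pverts G"
  shows "degree G u \<le> k"
proof -
  have "card (neighbours G u) \<le> card {1..k}"
    using injective_coloring_inj_on_neighbours[OF f u]
      injective_coloring_image_neighbours_subset[OF f] finite_atLeastAtMost
    by (rule card_inj_on_le)
  then show ?thesis by (simp add: degree_eq_card_neighbours)
qed

end

lemma (in pair_digraph) injective_coloring_prescribed_color: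
  assumes f: "injective_coloring G k f" and a: "a \<in> {1..Suc k}"
    and D: "finite D" "card D + degree G v \<le> k"
  obtains h where "injective_coloring G (Suc k) h" and "h v = a" and "h ` neighbours G v \<inter> D = {}"
proof -
  let ?N = "neighbours G v" and ?T = "{1..Suc k} - {a}"
  have "f ` ?N \<subseteq> {1..k}" using f by (rule injective_coloring_image_neighbours_subset)
  moreover have card_T: "card ?T = k" using a by simp
  moreover have "card (f ` ?N) \<le> card (?T - D)"
  proof -
    have "card (f ` ?N) \<le> degree G v"
      by (simp add: degree_eq_card_neighbours card_image_le[OF finite_neighbours])
    also have "\<dots> \<le> card ?T - card D" using D(2) card_T by simp
    also have "\<dots> \<le> card (?T - D)" using D(1) by (rule diff_card_le_card_Diff)
    finally show ?thesis .
  qed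
  ultimately obtain p where p: "inj_on p {1..k}" "p ` {1..k} \<subseteq> ?T" "p ` f ` ?N \<subseteq> ?T - D"
    using ex_inj_on_image_subset[of "{1..k}" ?T "f ` ?N" "?T - D"] by auto
  let ?h = "(p \<circ> f)(v := a)"
  show thesis
  proof (rule that)
    have "injective_coloring G (Suc k) (p \<circ> f)"
      using f p(1,2) by (intro injective_coloring_comp) auto
    moreover have "a \<notin> (p \<circ> f) ` pverts G"
      using injective_coloring_image_subset[OF f] p(2) by fastforce
    ultimately show "injective_coloring G (Suc k) ?h"
      using a by (intro injective_coloring_fun_upd_fresh)
    show "?h v = a" by simp
    have "v \<notin> ?N" using no_loops' by auto
    then have "?h ` ?N = p ` f ` ?N" by (simp only: fun_upd_image image_comp if_False)
    then show "?h ` ?N \<inter> D = {}" using p(3) by blast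
  qed
qed

context pair_graph
begin

lemma optimal_injective_coloring:
  obtains f where "injective_coloring G (injective_chromatic_number G) f"
proof -
  have "\<exists>f. injective_coloring G (injective_chromatic_number G) f"
    unfolding injective_chromatic_number_def
    using injective_coloring_exists[OF pair_graph] by (rule LeastI_ex)
  then show thesis using that by blast
qed

lemma injective_chromatic_number_le_iff:
  "injective_chromatic_number G \<le> k \<longleftrightarrow> (\<exists>f. injective_coloring G k f)"
proof
  assume "injective_chromatic_number G \<le> k"
  then show "\<exists>f. injective_coloring G k f"
    using optimal_injective_coloring injective_coloring_mono by metis
next
  assume "\<exists>f. injective_coloring G k f"
  then show "injective_chromatic_number G \<le> k"
    unfolding injective_chromatic_number_def by (rule Least_le)
qed

lemma degree_le_injective_chromatic_number:
  assumes "u \<in> pverts G"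
  shows "degree G u \<le> injective_chromatic_number G"
proof -
  obtain f where "injective_coloring G (injective_chromatic_number G) f"
    by (rule optimal_injective_coloring)
  then show ?thesis using assms by (rule degree_le_injective_coloring)
qed

end

lemma injective_chromatic_number_null:
  assumes "pverts G = {}"
  shows "injective_chromatic_number G = 0"
  using assms by (simp add: injective_chromatic_number_def injective_coloring_def)

lemma pverts_rooted_product: "pverts (rooted_product G H v) = pverts G \<times> pverts H"
  by (simp add: rooted_product_def)

lemma neighbours_rooted_product:
  assumes "g \<in> pverts G"
  shows "neighbours (rooted_product G H v) (g, h) =
    Pair g ` neighbours H h \<union> (if h = v then (\<lambda>g'. (g', v)) ` neighbours G g else {})"
  using assms by (auto simp: rooted_product_def)

locale rooted_product_graphs = G: pair_graph G + H: pair_graph H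
  for G :: "'a pair_pre_digraph" and H :: "'b pair_pre_digraph" +
  fixes v :: 'b
  assumes root_in_pverts: "v \<in> pverts H"
begin

sublocale product: pair_graph "rooted_product G H v"
  using G.pair_graph H.pair_graph root_in_pverts by (rule pair_graph_rooted_product)

lemma neighbours_root_disjoint:
  "Pair g ` neighbours H v \<inter> (\<lambda>g'. (g', v)) ` neighbours G g = {}"
  using G.no_loops' by auto

lemma degree_rooted_product_root:
  assumes "g \<in> pverts G"
  shows "degree (rooted_product G H v) (g, v) = degree G g + degree H v"
  using neighbours_root_disjoint
  by (simp add: degree_eq_card_neighbours neighbours_rooted_product[OF assms]
      card_Un_disjoint G.finite_neighbours H.finite_neighbours card_image inj_on_def)

lemma inj_on_neighbours_rooted_product_iff:
  assumes "g \<in> pverts G"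
  shows "inj_on f (neighbours (rooted_product G H v) (g, h)) \<longleftrightarrow>
    inj_on (\<lambda>h'. f (g, h')) (neighbours H h) \<and>
    (h = v \<longrightarrow> inj_on (\<lambda>g'. f (g', v)) (neighbours G g) \<and>
      (\<lambda>h'. f (g, h')) ` neighbours H v \<inter> (\<lambda>g'. f (g', v)) ` neighbours G g = {})"
proof -
  have inj_on: "inj_on f (Pair g ` N) \<longleftrightarrow> inj_on (\<lambda>h'. f (g, h')) N"
    "inj_on f ((\<lambda>g'. (g', v)) ` M) \<longleftrightarrow> inj_on (\<lambda>g'. f (g', v)) M" for N M
    by (auto simp: inj_on_def)
  show ?thesis
  proof (cases "h = v")
    case True
    let ?A = "Pair g ` neighbours H v" and ?B = "(\<lambda>g'. (g', v)) ` neighbours G g"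
    have "?A - ?B = ?A" "?B - ?A = ?B" using neighbours_root_disjoint by blast+
    with True show ?thesis
      by (simp add: neighbours_rooted_product[OF assms] inj_on_Un inj_on image_image)
  next
    case False
    then show ?thesis by (simp add: neighbours_rooted_product[OF assms] inj_on)
  qed
qed

lemma injective_coloring_rooted_product_iff:
  "injective_coloring (rooted_product G H v) k f \<longleftrightarrow>
    injective_coloring G k (\<lambda>g. f (g, v)) \<and>
    (\<forall>g\<in>pverts G. injective_coloring H k (\<lambda>h. f (g, h)) \<and>
      (\<lambda>h. f (g, h)) ` neighbours H v \<inter> (\<lambda>g'. f (g', v)) ` neighbours G g = {})"
proof -
  let ?P = "rooted_product G H v"
  let ?inj_on_base = "\<lambda>g. inj_on (\<lambda>g'. f (g', v)) (neighbours G g)"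
  let ?inj_on_fibre = "\<lambda>g h. inj_on (\<lambda>h'. f (g, h')) (neighbours H h)"
  let ?disjoint = "\<lambda>g. (\<lambda>h. f (g, h)) ` neighbours H v \<inter> (\<lambda>g'. f (g', v)) ` neighbours G g = {}"
  have range: "f ` pverts ?P \<subseteq> {1..k} \<longleftrightarrow> (\<lambda>g. f (g, v)) ` pverts G \<subseteq> {1..k} \<and>
      (\<forall>g\<in>pverts G. (\<lambda>h. f (g, h)) ` pverts H \<subseteq> {1..k})"
    using root_in_pverts by (auto simp: pverts_rooted_product image_subset_iff)
  have "(\<forall>x\<in>pverts ?P. inj_on f (neighbours ?P x)) \<longleftrightarrow>
      (\<forall>g\<in>pverts G. \<forall>h\<in>pverts H. ?inj_on_fibre g h \<and> (h = v \<longrightarrow> ?inj_on_base g \<and> ?disjoint g))"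
    by (simp add: pverts_rooted_product inj_on_neighbours_rooted_product_iff)
  also have "\<dots> \<longleftrightarrow> (\<forall>g\<in>pverts G. ?inj_on_base g) \<and>
      (\<forall>g\<in>pverts G. (\<forall>h\<in>pverts H. ?inj_on_fibre g h) \<and> ?disjoint g)"
    using root_in_pverts by blast
  finally show ?thesis
    unfolding injective_coloring_iff_inj_on range by (simp add: ball_conj_distrib conj_ac)
qed

lemma injective_chromatic_number_base_le:
  "injective_chromatic_number G \<le> injective_chromatic_number (rooted_product G H v)"
proof -
  obtain f where "injective_coloring (rooted_product G H v)
      (injective_chromatic_number (rooted_product G H v)) f"
    by (rule product.optimal_injective_coloring)
  then show ?thesis
    unfolding injective_coloring_rooted_product_iff G.injective_chromatic_number_le_iff by blast
qed

lemma injective_chromatic_number_fibre_le: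
  assumes "pverts G \<noteq> {}"
  shows "injective_chromatic_number H \<le> injective_chromatic_number (rooted_product G H v)"
proof -
  obtain f where "injective_coloring (rooted_product G H v)
      (injective_chromatic_number (rooted_product G H v)) f"
    by (rule product.optimal_injective_coloring)
  then show ?thesis
    unfolding injective_coloring_rooted_product_iff H.injective_chromatic_number_le_iff
    using assms by blast
qed

lemma max_degree_plus_degree_root_le_injective_chromatic_number:
  assumes "pverts G \<noteq> {}"
  shows "max_degree G + degree H v \<le> injective_chromatic_number (rooted_product G H v)"
proof -
  obtain g where g: "g \<in> pverts G" "degree G g = max_degree G"
    using assms by (rule G.max_degree_attained)
  then have "max_degree G + degree H v = degree (rooted_product G H v) (g, v)"
    by (simp add: degree_rooted_product_root)
  also have "\<dots> \<le> injective_chromatic_number (rooted_product G H v)"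
    using g(1) root_in_pverts
    by (intro product.degree_le_injective_chromatic_number) (simp add: pverts_rooted_product)
  finally show ?thesis .
qed

lemma injective_coloring_fibre_compatible:
  assumes c: "injective_coloring G k c" and f: "injective_coloring H k f"
    and k: "max_degree G + degree H v \<le> k" and g: "g \<in> pverts G"
  obtains h where "injective_coloring H (Suc k) h" and "h v = c g"
    and "h ` neighbours H v \<inter> c ` neighbours G g = {}"
proof -
  have "card (c ` neighbours G g) \<le> degree G g"
    by (simp add: degree_eq_card_neighbours card_image_le[OF G.finite_neighbours])
  then have "card (c ` neighbours G g) + degree H v \<le> k"
    using G.degree_le_max_degree[OF g] k by linarith
  moreover have "c g \<in> {1..Suc k}"
    using injective_coloring_image_subset[OF c] g by fastforce
  ultimately show thesis
    using H.injective_coloring_prescribed_color[OF f] G.finite_neighbours that by blast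
qed

lemma injective_chromatic_number_rooted_product_le_Suc:
  assumes G_le: "injective_chromatic_number G \<le> k" and H_le: "injective_chromatic_number H \<le> k"
    and degree_le: "max_degree G + degree H v \<le> k"
  shows "injective_chromatic_number (rooted_product G H v) \<le> Suc k"
proof -
  obtain c where c: "injective_coloring G k c"
    using G_le G.injective_chromatic_number_le_iff by blast
  obtain f where f: "injective_coloring H k f"
    using H_le H.injective_chromatic_number_le_iff by blast
  have "\<forall>g\<in>pverts G. \<exists>h. injective_coloring H (Suc k) h \<and> h v = c g \<and>
      h ` neighbours H v \<inter> c ` neighbours G g = {}"
    using injective_coloring_fibre_compatible[OF c f degree_le] by metis
  then obtain h where h: "\<forall>g\<in>pverts G. injective_coloring H (Suc k) (h g) \<and> h g v = c g \<and>
      h g ` neighbours H v \<inter> c ` neighbours G g = {}"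
    by (rule bchoice[THEN exE])
  then have root_color: "\<And>g. g \<in> pverts G \<Longrightarrow> h g v = c g" by blast
  have "injective_coloring G (Suc k) c"
    using c by (rule injective_coloring_mono) simp
  then have "injective_coloring G (Suc k) (\<lambda>g. h g v)"
    using G.injective_coloring_cong[of "\<lambda>g. h g v" c, OF root_color] by blast
  moreover have "(\<lambda>g'. h g' v) ` neighbours G g = c ` neighbours G g" for g
    by (intro image_cong refl root_color subsetD[OF G.neighbours_subset_pverts])
  ultimately have "injective_coloring (rooted_product G H v) (Suc k) (\<lambda>(g, x). h g x)"
    using h by (simp add: injective_coloring_rooted_product_iff)
  then show ?thesis
    using product.injective_chromatic_number_le_iff by blast
qed

end

theorem theorem4p6:
  fixes G :: "'a pair_pre_digraph" and H :: "'b pair_pre_digraph" and v :: 'b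
  assumes "pair_graph G" and "pair_graph H" and "v \<in> pverts H"
  shows "injective_chromatic_number (rooted_product G H v) \<in>
    {injective_chromatic_number G, injective_chromatic_number H,
     injective_chromatic_number G + 1, injective_chromatic_number H + 1,
     max_degree G + degree H v, max_degree G + degree H v + 1}"
proof (cases "pverts G = {}")
  case True
  then show ?thesis by (simp add: injective_chromatic_number_null pverts_rooted_product)
next
  case False
  interpret rooted_product_graphs G H v
    by (intro rooted_product_graphs.intro rooted_product_graphs_axioms.intro assms)
  let ?S = "{injective_chromatic_number G, injective_chromatic_number H, max_degree G + degree H v}"
  define M where "M = Max ?S"
  have "M \<le> injective_chromatic_number (rooted_product G H v)"
    using injective_chromatic_number_base_le injective_chromatic_number_fibre_le[OF False]
      max_degree_plus_degree_root_le_injective_chromatic_number[OF False] by (simp add: M_def)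
  moreover have "injective_chromatic_number (rooted_product G H v) \<le> Suc M"
    by (rule injective_chromatic_number_rooted_product_le_Suc) (simp_all add: M_def)
  ultimately have "injective_chromatic_number (rooted_product G H v) \<in> {M, M + 1}" by auto
  moreover have "M \<in> ?S" unfolding M_def by (rule Max_in) simp_all
  ultimately show ?thesis by blast
qed

end
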